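(* Let $(\Omega,\mathcal{B},\mu)$ be a $\sigma$-finite measure space with $\mu(\Omega)=\infty$, and let $T:\Omega\to\Omega$ be a conservative, invertible, measure-preserving, ergodic transformation on $(\Omega,\mathcal{B},\mu)$. Then there exist a $\mathcal{B}$-measurable function $f:\Omega\to\{0,1\}$ and two strictly increasing sequences $\{p_k\}$ and $\{q_k\}$ of positive integers such that $$\lim_{k\to\infty}A_{p_k}(\omega,f,T)=1\quad\text{and}\quad \lim_{k\to\infty}A_{q_k}(\omega,f,T)=0\qquad\text{for }\mu\text{-a.e. }\omega\in\Omega.$$ In particular, $$\limsup_{n\to\infty}A_n(\omega,f,T)=1\quad\text{and}\quad \liminf_{n\to\infty}A_n(\omega,f,T)=0\qquad\text{for }\mu\text{-a.e. }\omega\in\Omega.$$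
   Context: For a measurable $T:\Omega\to\Omega$, a measurable $f:\Omega\to\mathbb{R}$ and $n\in\mathbb{N}=\{1,2,\dots\}$, $A_n(\omega,f,T)=\frac1n\sum_{k=0}^{n-1}f(T^k\omega)$. A measurable transformation $T$ is: invertible if it is bijective and $T^{-1}$ is measurable; measure-preserving if $\mu(T^{-1}E)=\mu(E)$ for all $E\in\mathcal{B}$; ergodic if $T^{-1}E=E$ (with $E\in\mathcal{B}$) implies $\mu(E)=0$ or $\mu(\Omega\setminus E)=0$; conservative if there is no $W\in\mathcal{B}$ with $\mu(W)>0$ such that the sets $T^{-n}W$, $n\ge 0$, are pairwise disjoint. *)

theory Defs
  imports "HOL-Analysis.Analysis"
begin

text \<open>
  The underlying set of the measure space is the space of \<open>M\<close>, which need not be the whole type.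
  A transformation is a function that is measurable from \<open>M\<close> to \<open>M\<close>, so it maps the space of \<open>M\<close>
  into itself; its values elsewhere play no role, and every preimage is taken within the space.
\<close>

text \<open>Intended for \<open>n > 0\<close>; the value at \<open>n = 0\<close> is \<open>0\<close>.\<close>

definition ergodic_average :: "nat \<Rightarrow> 'a \<Rightarrow> ('a \<Rightarrow> real) \<Rightarrow> ('a \<Rightarrow> 'a) \<Rightarrow> real" where
  "ergodic_average n \<omega> f T = (1 / real n) * (\<Sum>k<n. f ((T ^^ k) \<omega>))"

definition invertible_transformation :: "'a measure \<Rightarrow> ('a \<Rightarrow> 'a) \<Rightarrow> bool" where
  "invertible_transformation M T \<longleftrightarrow>
     bij_betw T (space M) (space M) \<and> the_inv_into (space M) T \<in> measurable M M"

definition measure_preserving :: "'a measure \<Rightarrow> ('a \<Rightarrow> 'a) \<Rightarrow> bool" where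
  "measure_preserving M T \<longleftrightarrow>
     (\<forall>E\<in>sets M. emeasure M (T -` E \<inter> space M) = emeasure M E)"

definition ergodic :: "'a measure \<Rightarrow> ('a \<Rightarrow> 'a) \<Rightarrow> bool" where
  "ergodic M T \<longleftrightarrow>
     (\<forall>E\<in>sets M. T -` E \<inter> space M = E \<longrightarrow>
        emeasure M E = 0 \<or> emeasure M (space M - E) = 0)"

definition conservative :: "'a measure \<Rightarrow> ('a \<Rightarrow> 'a) \<Rightarrow> bool" where
  "conservative M T \<longleftrightarrow>
     \<not> (\<exists>W\<in>sets M. emeasure M W > 0 \<and>
          disjoint_family (\<lambda>n::nat. (T ^^ n) -` W \<inter> space M))"

end

theory Submission
  imports Defs
begin

text \<open>
  The orbit averages of the indicator of a set of finite measure tend to 0 almost everywhere: by the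
  weak-type maximal inequality the invariant set on which their upper limit exceeds a given positive
  constant has finite measure, so it is null. Now exhaust the space by sets \<open>X k\<close> of finite
  measure. Given a set \<open>H k\<close> of finite measure of points whose membership in the target set is
  already decided, choose a time \<open>n k\<close> so large that most orbits of length \<open>n k\<close> starting in
  \<open>X k\<close> spend a small proportion of time in \<open>H k\<close>, and decide all remaining points of these orbits
  at once: they are put into the target set for even \<open>k\<close> and left out for odd \<open>k\<close>. By
  Borel--Cantelli the averages at the times \<open>n k\<close> tend to 1 along even \<open>k\<close> and to 0 along odd \<open>k\<close>.
\<close>

section \<open>Elementary properties of orbit averages\<close>

lemma ergodic_average_ge_iff:
  assumes "n > 0"
  shows "c \<le> ergodic_average n x g T \<longleftrightarrow> c * real n \<le> (\<Sum>k<n. g ((T ^^ k) x))"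
  using assms by (simp add: ergodic_average_def pos_le_divide_eq)

lemma ergodic_average_indicator_bounds:
  "0 \<le> ergodic_average n x (indicator B) T" "ergodic_average n x (indicator B) T \<le> 1"
proof -
  have "(\<Sum>k<n. indicator B ((T ^^ k) x)) \<le> (\<Sum>k<n. 1::real)"
    by (rule sum_mono) (simp add: indicator_def)
  then show "ergodic_average n x (indicator B) T \<le> 1"
    by (cases n) (simp_all add: ergodic_average_def divide_le_eq_1)
  show "0 \<le> ergodic_average n x (indicator B) T"
    by (simp add: ergodic_average_def sum_nonneg)
qed

lemma measurable_ergodic_average [measurable]:
  assumes [measurable]: "T \<in> measurable M M" "g \<in> borel_measurable M"
  shows "(\<lambda>x. ergodic_average n x g T) \<in> borel_measurable M"
  unfolding ergodic_average_def by measurable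

section \<open>The weak-type maximal inequality\<close>

lemma orbit_sum_split:
  fixes g :: "'a \<Rightarrow> real"
  shows "(\<Sum>k<m + n. g ((T ^^ k) x)) = (\<Sum>k<m. g ((T ^^ k) x)) + (\<Sum>k<n. g ((T ^^ k) ((T ^^ m) x)))"
  by (induction n) (simp_all add: funpow_add add.commute[of m] del: funpow.simps)

text \<open>Greedy covering of an orbit segment: at a visit to \<open>D\<close>, jump over a block on which the
  average of \<open>g\<close> is at least \<open>c\<close>; otherwise advance by one step.\<close>

lemma orbit_covering:
  fixes g :: "'a \<Rightarrow> real"
  assumes g: "\<And>x. 0 \<le> g x" and c: "0 \<le> c"
    and D: "\<And>x. x \<in> D \<Longrightarrow> \<exists>n. 0 < n \<and> n \<le> N \<and> c * real n \<le> (\<Sum>k<n. g ((T ^^ k) x))"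
  shows "c * (\<Sum>k<L. indicator D ((T ^^ k) x)) \<le> (\<Sum>k<L + N. g ((T ^^ k) x))"
proof (induction L arbitrary: x rule: less_induct)
  case (less L)
  have count: "(\<Sum>k<m. indicator D ((T ^^ k) x)) \<le> real m" for m x
    using sum_mono[of "{..<m}" "\<lambda>k. indicator D ((T ^^ k) x)" "\<lambda>_. 1::real"]
    by (simp add: indicator_def)
  have mono: "(\<Sum>k<m. g ((T ^^ k) x)) \<le> (\<Sum>k<m'. g ((T ^^ k) x))" if "m \<le> m'" for m m'
    using that g by (intro sum_mono2) auto
  consider "L = 0" | "L > 0" "x \<notin> D" | "x \<in> D" by blast
  then show ?case
  proof cases
    case 1
    then show ?thesis using g by (simp add: sum_nonneg)
  next
    case 2
    then obtain K where K: "L = 1 + K" by (metis Suc_pred plus_1_eq_Suc)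
    have "c * (\<Sum>k<L. indicator D ((T ^^ k) x)) = c * (\<Sum>k<K. indicator D ((T ^^ k) ((T ^^ 1) x)))"
      unfolding K orbit_sum_split[where m=1 and n=K] using 2 by simp
    also have "\<dots> \<le> (\<Sum>k<K + N. g ((T ^^ k) ((T ^^ 1) x)))"
      using less K by simp
    also have "\<dots> \<le> (\<Sum>k<1 + (K + N). g ((T ^^ k) x))"
      unfolding orbit_sum_split[where m=1 and n="K + N"] using g by simp
    finally show ?thesis by (simp add: K)
  next
    case 3
    then obtain n where n: "0 < n" "n \<le> N" "c * real n \<le> (\<Sum>k<n. g ((T ^^ k) x))"
      using D by blast
    show ?thesis
    proof (cases "n < L")
      case True
      then obtain K where K: "L = n + K" using less_imp_add_positive by blast
      have "c * (\<Sum>k<L. indicator D ((T ^^ k) x))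
          = c * (\<Sum>k<n. indicator D ((T ^^ k) x)) + c * (\<Sum>k<K. indicator D ((T ^^ k) ((T ^^ n) x)))"
        unfolding K orbit_sum_split[where m=n and n=K] by (simp add: distrib_left)
      also have "\<dots> \<le> c * real n + (\<Sum>k<K + N. g ((T ^^ k) ((T ^^ n) x)))"
        using less K n count[where m=n and x=x] c by (intro add_mono mult_left_mono) auto
      also have "\<dots> \<le> (\<Sum>k<n + (K + N). g ((T ^^ k) x))"
        unfolding orbit_sum_split[where m=n and n="K + N"] using n by simp
      finally show ?thesis by (simp add: K add.assoc)
    next
      case False
      \<comment> \<open>The last block may run past \<open>L\<close>, but by at most
        \<open>N\<close> steps; the \<open>N\<close> extra terms on the right-hand side are there to
        absorb it.\<close>
      have "c * (\<Sum>k<L. indicator D ((T ^^ k) x)) \<le> c * real n"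
        using False count[where m=L and x=x] c by (intro mult_left_mono) auto
      also have "\<dots> \<le> (\<Sum>k<L + N. g ((T ^^ k) x))"
        using n(2,3) mono[of n "L + N"] by linarith
      finally show ?thesis .
    qed
  qed
qed

lemma emeasure_vimage_funpow:
  assumes T: "T \<in> measurable M M" "measure_preserving M T" and E: "E \<in> sets M"
  shows "emeasure M ((T ^^ k) -` E \<inter> space M) = emeasure M E"
proof (induction k)
  case 0
  then show ?case using sets.sets_into_space[OF E] by (simp add: Int_absorb2)
next
  case (Suc k)
  have [measurable]: "(T ^^ k) \<in> measurable M M" using T(1) by simp
  have "(T ^^ k) -` E \<inter> space M \<in> sets M" using E by measurable
  moreover have "(T ^^ Suc k) -` E \<inter> space M = T -` ((T ^^ k) -` E \<inter> space M) \<inter> space M"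
    using measurable_space[OF T(1)] by (auto simp: funpow_Suc_right simp del: funpow.simps)
  ultimately show ?case
    using T(2) Suc unfolding measure_preserving_def by metis
qed

text \<open>Every iterate of \<open>T\<close> preserves the measure, so each of the \<open>n\<close>
  visit times contributes the measure of \<open>E\<close>. This turns pointwise counts along orbits
  into inequalities between measures.\<close>

lemma nn_integral_orbit_count:
  assumes [measurable]: "T \<in> measurable M M" and "measure_preserving M T"
    and [measurable]: "E \<in> sets M"
  shows "(\<integral>\<^sup>+x. (\<Sum>k<n. indicator E ((T ^^ k) x)) \<partial>M) = of_nat n * emeasure M E"
proof -
  have "(\<integral>\<^sup>+x. indicator E ((T ^^ k) x) \<partial>M) = emeasure M E" for k
  proof -
    have "(\<integral>\<^sup>+x. indicator E ((T ^^ k) x) \<partial>M)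
        = (\<integral>\<^sup>+x. indicator ((T ^^ k) -` E \<inter> space M) x \<partial>M)"
      by (intro nn_integral_cong) (simp add: indicator_def)
    then show ?thesis
      using assms by (simp add: emeasure_vimage_funpow)
  qed
  then show ?thesis
    by (subst nn_integral_sum) auto
qed

text \<open>Integrating the orbit covering over the whole space gives
  \<open>c * L * \<mu>(D) \<le> (L + N) * \<mu>(B)\<close> for all \<open>L\<close>. Dividing by
  \<open>L\<close> and letting \<open>L\<close> grow removes \<open>N\<close>. The bound
  \<open>N\<close> on the averaging time limits the block lengths, as the covering requires.\<close>

lemma maximal_inequality_bounded:
  fixes c :: real and N :: nat
  assumes T [measurable]: "T \<in> measurable M M" "measure_preserving M T"
    and B [measurable]: "B \<in> sets M" and fin: "emeasure M B < \<infinity>" and c: "c > 0"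
  defines "D \<equiv> {x\<in>space M. \<exists>n\<in>{0<..N}. c \<le> ergodic_average n x (indicator B) T}"
  shows "ennreal c * emeasure M D \<le> emeasure M B"
proof -
  have [measurable]: "D \<in> sets M" unfolding D_def by measurable
  have count: "ennreal c * (of_nat L * emeasure M D) \<le> of_nat (L + N) * emeasure M B" for L
  proof -
    have pw: "ennreal c * (\<Sum>k<L. indicator D ((T ^^ k) x)) \<le> (\<Sum>k<L + N. indicator B ((T ^^ k) x))" for x
    proof -
      have "c * (\<Sum>k<L. indicator D ((T ^^ k) x)) \<le> (\<Sum>k<L + N. indicator B ((T ^^ k) x))"
      proof (rule orbit_covering)
        fix x assume "x \<in> D"
        then obtain n where "0 < n" "n \<le> N" "c \<le> ergodic_average n x (indicator B) T"
          by (auto simp: D_def)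
        then show "\<exists>n. 0 < n \<and> n \<le> N \<and> c * real n \<le> (\<Sum>k<n. indicator B ((T ^^ k) x))"
          by (auto simp flip: ergodic_average_ge_iff)
      qed (use c in auto)
      then have "ennreal (c * (\<Sum>k<L. indicator D ((T ^^ k) x)))
          \<le> ennreal (\<Sum>k<L + N. indicator B ((T ^^ k) x))"
        by (rule ennreal_leI)
      then show ?thesis
        using c by (simp add: ennreal_mult sum_nonneg ennreal_indicator flip: sum_ennreal)
    qed
    have "ennreal c * (of_nat L * emeasure M D)
        = (\<integral>\<^sup>+x. ennreal c * (\<Sum>k<L. indicator D ((T ^^ k) x)) \<partial>M)"
      using nn_integral_orbit_count[OF T, of D L] by (subst nn_integral_cmult) auto
    also have "\<dots> \<le> (\<integral>\<^sup>+x. (\<Sum>k<L + N. indicator B ((T ^^ k) x)) \<partial>M)"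
      using pw by (intro nn_integral_mono) auto
    finally show ?thesis using nn_integral_orbit_count[OF T B] by simp
  qed
  \<comment> \<open>The case \<open>L = 1\<close> already shows that \<open>D\<close> has finite
    measure, so that the inequalities can be moved to the reals, where subtraction is
    available.\<close>
  have "ennreal c * emeasure M D \<le> of_nat (1 + N) * emeasure M B"
    using count[of 1] by simp
  also have "\<dots> < \<infinity>"
    using fin by (simp add: ennreal_mult_less_top of_nat_less_top del: of_nat_add of_nat_Suc)
  finally have "ennreal c * emeasure M D < \<infinity>" .
  then have "emeasure M D < \<infinity>"
    using c by (auto simp: ennreal_mult_less_top)
  then have eq: "emeasure M D = ennreal (measure M D)" "emeasure M B = ennreal (measure M B)"
    using fin by (auto simp: emeasure_eq_ennreal_measure)
  have "real L * (c * measure M D - measure M B) \<le> real N * measure M B" for L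
  proof -
    have "ennreal (c * (real L * measure M D)) \<le> ennreal (real (L + N) * measure M B)"
      using count[of L] c unfolding eq
      by (simp add: ennreal_mult ennreal_of_nat_eq_real_of_nat del: of_nat_add)
    then have "c * (real L * measure M D) \<le> real (L + N) * measure M B"
      by (subst (asm) ennreal_le_iff) auto
    then show ?thesis by (simp add: algebra_simps)
  qed
  \<comment> \<open>If the difference were positive, a large multiple of it would exceed the fixed
    number \<open>N * \<mu>(B)\<close>.\<close>
  then have "c * measure M D \<le> measure M B"
    using reals_Archimedean3[of "c * measure M D - measure M B"] by (meson not_le diff_gt_0_iff_gt)
  then show ?thesis
    using c unfolding eq by (simp flip: ennreal_mult)
qed

text \<open>The bound for averaging times up to \<open>N\<close> does not depend on
  \<open>N\<close>, and the sets increase with \<open>N\<close>; continuity from below gives the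
  claim.\<close>

lemma maximal_inequality:
  fixes c :: real
  assumes T [measurable]: "T \<in> measurable M M" "measure_preserving M T"
    and B [measurable]: "B \<in> sets M" and fin: "emeasure M B < \<infinity>" and c: "c > 0"
  shows "ennreal c * emeasure M {x\<in>space M. \<exists>n>0. c \<le> ergodic_average n x (indicator B) T}
    \<le> emeasure M B"
proof -
  let ?D = "\<lambda>N. {x\<in>space M. \<exists>n\<in>{0<..N}. c \<le> ergodic_average n x (indicator B) T}"
  have "{x\<in>space M. \<exists>n>0. c \<le> ergodic_average n x (indicator B) T} = (\<Union>N. ?D N)"
    by fastforce
  moreover have "(SUP N. emeasure M (?D N)) = emeasure M (\<Union>N. ?D N)"
    by (intro SUP_emeasure_incseq) (auto simp: incseq_def)
  moreover have "ennreal c * (SUP N. emeasure M (?D N)) \<le> emeasure M B"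
    unfolding SUP_mult_left_ennreal by (intro SUP_least maximal_inequality_bounded T B fin c)
  ultimately show ?thesis by simp
qed

section \<open>Decay of the averages for sets of finite measure\<close>

text \<open>Moving the starting point by one step adds one term to the orbit sum and removes
  another, so the average changes by at most \<open>1 / n\<close>. Sets defined through this upper
  limit are therefore invariant.\<close>

lemma limsup_ergodic_average_shift:
  "limsup (\<lambda>n. ereal (ergodic_average n (T x) (indicator B) T))
     = limsup (\<lambda>n. ereal (ergodic_average n x (indicator B) T))"
proof -
  let ?d = "\<lambda>n. (indicator B ((T ^^ n) x) - indicator B x) / real n"
  have shift: "ergodic_average n (T x) (indicator B) T = ?d n + ergodic_average n x (indicator B) T" for n
  proof -
    have "(\<Sum>k<n. indicator B ((T ^^ k) (T x)))
        = indicator B ((T ^^ n) x) - indicator B x + (\<Sum>k<n. indicator B ((T ^^ k) x) :: real)"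
      by (induction n) (simp_all add: funpow_swap1)
    then show ?thesis
      by (simp add: ergodic_average_def add_divide_distrib)
  qed
  have "?d \<longlonglongrightarrow> 0"
  proof (rule Lim_null_comparison)
    \<comment> \<open>The bound holds for \<open>n = 0\<close> as well, since division by zero
      yields 0 on both sides.\<close>
    show "\<forall>\<^sub>F n in sequentially. norm (?d n) \<le> 1 / real n"
      by (intro always_eventually allI) (auto simp: indicator_def)
  qed (rule lim_1_over_n)
  then have "(\<lambda>n. ereal (?d n)) \<longlonglongrightarrow> ereal 0"
    by (simp add: tendsto_ereal)
  then have "limsup (\<lambda>n. ereal (?d n) + ereal (ergodic_average n x (indicator B) T))
      = 0 + limsup (\<lambda>n. ereal (ergodic_average n x (indicator B) T))"
    by (intro ereal_limsup_lim_add) (auto simp: zero_ereal_def)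
  then show ?thesis by (simp add: shift)
qed

lemma AE_ergodic_average_tendsto_0:
  assumes T [measurable]: "T \<in> measurable M M" "measure_preserving M T"
    and erg: "ergodic M T" and inf: "emeasure M (space M) = \<infinity>"
    and B [measurable]: "B \<in> sets M" and fin: "emeasure M B < \<infinity>"
  shows "AE x in M. (\<lambda>n. ergodic_average n x (indicator B) T) \<longlonglongrightarrow> 0"
proof -
  let ?A = "\<lambda>n x. ergodic_average n x (indicator B) T"
  have le: "AE x in M. limsup (\<lambda>n. ereal (?A n x)) \<le> ereal c" if c: "c > 0" for c :: real
  proof -
    define E where "E = {x\<in>space M. ereal c < limsup (\<lambda>n. ereal (?A n x))}"
    have [measurable]: "E \<in> sets M" unfolding E_def by measurable
    have "E \<subseteq> {x\<in>space M. \<exists>n>0. c \<le> ?A n x}"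
    proof
      fix x assume x: "x \<in> E"
      have "\<exists>n>0. c \<le> ?A n x"
      proof (rule ccontr)
        assume none: "\<not> (\<exists>n>0. c \<le> ?A n x)"
        have "limsup (\<lambda>n. ereal (?A n x)) \<le> ereal c"
        proof (rule Limsup_bounded)
          show "\<forall>\<^sub>F n in sequentially. ereal (?A n x) \<le> ereal c"
            using eventually_gt_at_top[of 0]
          proof eventually_elim
            case (elim n)
            then have "\<not> c \<le> ?A n x" using none by blast
            then show ?case by simp
          qed
        qed
        then show False using x by (simp add: E_def flip: not_le)
      qed
      then show "x \<in> {x\<in>space M. \<exists>n>0. c \<le> ?A n x}" using x by (simp add: E_def)
    qed
    then have "emeasure M E \<le> emeasure M {x\<in>space M. \<exists>n>0. c \<le> ?A n x}"
      by (intro emeasure_mono) measurable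
    also have "\<dots> < \<infinity>"
      using le_less_trans[OF maximal_inequality[OF T B fin c] fin] c
      by (auto simp add: ennreal_mult_less_top)
    finally have E_fin: "emeasure M E < \<infinity>" .
    have "T -` E \<inter> space M = E"
      using measurable_space[OF T(1)] by (auto simp: E_def limsup_ergodic_average_shift)
    then have "emeasure M E = 0 \<or> emeasure M (space M - E) = 0"
      using erg by (simp add: ergodic_def)
    \<comment> \<open>A null complement would make the whole space have finite measure; this
      excludes the second alternative of ergodicity.\<close>
    moreover have "emeasure M (space M) \<le> emeasure M E + emeasure M (space M - E)"
      using sets.sets_into_space[of E M] by (subst plus_emeasure) (auto simp: Un_absorb1)
    ultimately have "emeasure M E = 0"
      using inf E_fin by auto
    then show ?thesis
      by (intro AE_I[of _ _ E]) (auto simp: E_def not_le)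
  qed
  \<comment> \<open>The constants \<open>1 / Suc m\<close> suffice, and being countably many they
    share one exceptional null set.\<close>
  have "AE x in M. \<forall>m. limsup (\<lambda>n. ereal (?A n x)) \<le> ereal (1 / Suc m)"
    unfolding AE_all_countable using le by simp
  then show ?thesis
  proof (rule AE_mp, intro AE_I2 impI)
    fix x assume *: "\<forall>m. limsup (\<lambda>n. ereal (?A n x)) \<le> ereal (1 / Suc m)"
    have "(\<lambda>m. ereal (1 / Suc m)) \<longlonglongrightarrow> ereal 0"
      using LIMSEQ_Suc[OF lim_1_over_n[where 'a=real]] by (simp add: tendsto_ereal)
    then have "limsup (\<lambda>n. ereal (?A n x)) \<le> 0"
      using LIMSEQ_le_const[of "\<lambda>m. ereal (1 / Suc m)"] * by (metis zero_ereal_def)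
    moreover have "0 \<le> liminf (\<lambda>n. ereal (?A n x))"
      by (intro Liminf_bounded) (simp add: ergodic_average_indicator_bounds)
    ultimately have "(\<lambda>n. ereal (?A n x)) \<longlonglongrightarrow> 0"
      using Liminf_le_Limsup[of sequentially "\<lambda>n. ereal (?A n x)"]
      by (intro Liminf_eq_Limsup) auto
    then show "(\<lambda>n. ?A n x) \<longlonglongrightarrow> 0" by (simp add: zero_ereal_def)
  qed
qed

text \<open>Convergence almost everywhere implies convergence in measure on a set of finite measure.
  The time can be taken beyond any given \<open>m\<close>, which later makes the chosen times
  strictly increasing.\<close>

lemma ergodic_average_small_in_measure:
  assumes T [measurable]: "T \<in> measurable M M" "measure_preserving M T"
    and erg: "ergodic M T" and inf: "emeasure M (space M) = \<infinity>"
    and B [measurable]: "B \<in> sets M" and fin: "emeasure M B < \<infinity>"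
    and X [measurable]: "X \<in> sets M" and Xfin: "emeasure M X < \<infinity>"
    and pos: "c > 0" "e > 0"
  shows "\<exists>n>m. emeasure M {x\<in>X. c \<le> ergodic_average n x (indicator B) T} < e"
proof -
  let ?A = "\<lambda>n x. ergodic_average n x (indicator B) T"
  \<comment> \<open>Allowing all times from \<open>m\<close> on makes these sets decrease, with a
    null intersection; since \<open>X\<close> has finite measure, continuity from above
    applies.\<close>
  define Z where "Z m = {x\<in>space M. x \<in> X \<and> (\<exists>n\<ge>m. c \<le> ?A n x)}" for m
  have Zm [measurable]: "Z m \<in> sets M" for m unfolding Z_def by measurable
  have Zfin: "emeasure M (Z m) < \<infinity>" for m
    using Xfin by (rule le_less_trans[rotated]) (auto simp: Z_def intro!: emeasure_mono)
  have "AE x in M. x \<notin> (\<Inter>m. Z m)"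
    using AE_ergodic_average_tendsto_0[OF T erg inf B fin]
  proof (rule AE_mp, intro AE_I2 impI)
    fix x assume "(\<lambda>n. ?A n x) \<longlonglongrightarrow> 0"
    then have "\<forall>\<^sub>F n in sequentially. ?A n x < c"
      using pos(1) by (rule order_tendstoD)
    then show "x \<notin> (\<Inter>m. Z m)"
      by (force simp: Z_def eventually_sequentially not_le[symmetric])
  qed
  then have "emeasure M (\<Inter>m. Z m) = 0"
    by (subst (asm) AE_iff_measurable[of "\<Inter>m. Z m"]) (auto simp: Z_def)
  moreover have "(\<lambda>m. emeasure M (Z m)) \<longlonglongrightarrow> emeasure M (\<Inter>m. Z m)"
    using Zfin by (intro Lim_emeasure_decseq) (auto simp: decseq_def Z_def less_top[symmetric] intro: order_trans)
  ultimately have "\<forall>\<^sub>F n in sequentially. n > m \<and> emeasure M (Z n) < e"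
    using pos(2) by (intro eventually_conj eventually_gt_at_top) (simp add: order_tendstoD)
  then obtain n where n: "n > m" "emeasure M (Z n) < e"
    using eventually_happens'[OF sequentially_bot] by blast
  have "emeasure M {x\<in>X. c \<le> ?A n x} \<le> emeasure M (Z n)"
    using sets.sets_into_space[OF X] by (intro emeasure_mono) (auto simp: Z_def)
  then show ?thesis using n by (auto intro: le_less_trans)
qed

section \<open>Construction of the target set and its averages\<close>

text \<open>The image under \<open>T\<close> is the preimage under the measurable inverse, hence
  measurable; by injectivity the preimage of the image is the original set, so the measure is kept.
  The points of the orbit segments starting in \<open>X\<close> form a union of such images.\<close>

lemma forward_image:
  assumes T: "T \<in> measurable M M" "measure_preserving M T" "invertible_transformation M T"
    and X: "X \<in> sets M"
  shows "(T ^^ j) ` X \<in> sets M \<and> emeasure M ((T ^^ j) ` X) = emeasure M X"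
proof (induction j)
  case (Suc j)
  let ?Y = "(T ^^ j) ` X"
  have Y: "?Y \<subseteq> space M" using Suc sets.sets_into_space by blast
  have bij: "inj_on T (space M)" "T ` space M = space M"
    and S: "the_inv_into (space M) T \<in> measurable M M"
    using T(3) by (auto simp: invertible_transformation_def bij_betw_def)
  have "T ` ?Y = the_inv_into (space M) T -` ?Y \<inter> space M"
  proof (intro equalityI subsetI)
    fix z assume "z \<in> T ` ?Y"
    then obtain y where "y \<in> ?Y" "z = T y" by blast
    then show "z \<in> the_inv_into (space M) T -` ?Y \<inter> space M"
      using Y bij the_inv_into_f_f[OF bij(1), of y] by auto
  next
    fix z assume z: "z \<in> the_inv_into (space M) T -` ?Y \<inter> space M"
    then have "T (the_inv_into (space M) T z) = z"
      using f_the_inv_into_f[OF bij(1), of z] bij(2) by simp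
    then show "z \<in> T ` ?Y"
      using z by (metis IntD1 imageI vimageD)
  qed
  then have sets: "T ` ?Y \<in> sets M"
    using measurable_sets[OF S] Suc by simp
  have "T -` (T ` ?Y) \<inter> space M = ?Y"
    using Y bij(1) by (auto dest: inj_onD)
  then have "emeasure M (T ` ?Y) = emeasure M ?Y"
    using T(2) sets unfolding measure_preserving_def by metis
  then show ?case using sets Suc by (simp add: image_comp[symmetric] o_def image_image)
qed (use X in simp)

theorem theorem2p1:
  fixes M :: "'a measure" and T :: "'a \<Rightarrow> 'a"
  assumes "sigma_finite_measure M"
    and "emeasure M (space M) = \<infinity>"
    and "T \<in> measurable M M"
    and "conservative M T"
    and "invertible_transformation M T"
    and "measure_preserving M T"
    and "ergodic M T"
  shows "\<exists>(f :: 'a \<Rightarrow> real) (p :: nat \<Rightarrow> nat) (q :: nat \<Rightarrow> nat).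
           f \<in> borel_measurable M \<and> f \<in> space M \<rightarrow> {0, 1} \<and>
           strict_mono p \<and> (\<forall>k. p k > 0) \<and>
           strict_mono q \<and> (\<forall>k. q k > 0) \<and>
           (AE \<omega> in M. (\<lambda>k. ergodic_average (p k) \<omega> f T) \<longlonglongrightarrow> 1 \<and>
                       (\<lambda>k. ergodic_average (q k) \<omega> f T) \<longlonglongrightarrow> 0) \<and>
           (AE \<omega> in M. limsup (\<lambda>n. ereal (ergodic_average n \<omega> f T)) = 1 \<and>
                       liminf (\<lambda>n. ereal (ergodic_average n \<omega> f T)) = 0)"
proof -
  note T [measurable] = assms(3,6) and inf = assms(2) and erg = assms(7) and inv = assms(5)
  interpret sigma_finite_measure M by fact
  obtain X :: "nat \<Rightarrow> 'a set" where X: "range X \<subseteq> sets M" "(\<Union>i. X i) = space M"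
    "\<And>i. emeasure M (X i) \<noteq> \<infinity>" "incseq X"
    using sigma_finite_incseq by blast
  have X_sets [measurable]: "X k \<in> sets M" for k using X(1) by blast
  have X_fin: "emeasure M (X k) < \<infinity>" for k using X(3) by (simp add: less_top)
  let ?av = "\<lambda>n x H. ergodic_average n x (indicator H) T"
  \<comment> \<open>The threshold \<open>1 / Suc k\<close> tends to 0, and the measure bound
    \<open>(1/2) ^ k\<close> imposed in \<open>P\<close> is summable, as Borel-Cantelli
    requires.\<close>
  define bad where "bad k H n = {x\<in>X k. 1 / Suc k \<le> ?av n x H}" for k n H
  define P where "P k y \<longleftrightarrow> fst y \<in> sets M \<and> emeasure M (fst y) < \<infinity> \<and> 0 < snd y \<and>
    emeasure M (bad k (fst y) (snd y)) < ennreal ((1/2) ^ k)" for k and y :: "'a set \<times> nat"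
  define Q where "Q k y z \<longleftrightarrow> snd y < snd z \<and> fst z = fst y \<union> (\<Union>j<snd y. (T ^^ j) ` X k)"
    for k and y z :: "'a set \<times> nat"
  have small: "\<exists>n>m. emeasure M (bad k H n) < ennreal ((1/2) ^ k)"
    if "H \<in> sets M" "emeasure M H < \<infinity>" for k m H
    unfolding bad_def using ergodic_average_small_in_measure[OF T erg inf that X_sets X_fin] by simp
  \<comment> \<open>The state is the pair of decided set and time. The two must be chosen
    alternately: the time depends on the current decided set, and the next decided set depends on
    that time. At the start nothing is decided.\<close>
  have "\<exists>s. \<forall>k. P k (s k) \<and> Q k (s k) (s (Suc k))"
  proof (rule dependent_nat_choice)
    obtain n where "n > 0" "emeasure M (bad 0 {} n) < ennreal ((1/2) ^ 0)"
      using small[of "{}" 0 0] by auto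
    then have "P 0 ({}, n)" by (simp add: P_def)
    then show "\<exists>y. P 0 y" ..
  next
    fix y :: "'a set \<times> nat" and k assume y: "P k y"
    define H where "H = fst y \<union> (\<Union>j<snd y. (T ^^ j) ` X k)"
    note img = forward_image[OF T inv X_sets[of k]]
    have H_sets: "H \<in> sets M" using y img unfolding H_def P_def by auto
    have "emeasure M H \<le> emeasure M (fst y) + emeasure M (\<Union>j<snd y. (T ^^ j) ` X k)"
      using y img unfolding H_def P_def by (intro emeasure_subadditive) auto
    also have "\<dots> \<le> emeasure M (fst y) + (\<Sum>j<snd y. emeasure M ((T ^^ j) ` X k))"
      using img by (intro add_left_mono emeasure_subadditive_finite) auto
    also have "\<dots> < \<infinity>"
      \<comment> \<open>Only finitely many images are added, each with the finite measure of
        \<open>X k\<close>.\<close>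
      using y img X_fin by (simp add: P_def ennreal_mult_less_top of_nat_less_top)
    finally have H_fin: "emeasure M H < \<infinity>" .
    then obtain n where "n > snd y" "emeasure M (bad (Suc k) H n) < ennreal ((1/2) ^ Suc k)"
      using small[OF H_sets] by blast
    then have "P (Suc k) (H, n) \<and> Q k y (H, n)"
      using H_fin H_sets by (auto simp: P_def Q_def H_def)
    then show "\<exists>z. P (Suc k) z \<and> Q k y z" ..
  qed
  then obtain s where s: "\<And>k. P k (s k)" "\<And>k. Q k (s k) (s (Suc k))" by blast
  define H where "H k = fst (s k)" for k
  define n where "n k = snd (s k)" for k
  have H_sets [measurable]: "H k \<in> sets M" for k using s(1) by (simp add: P_def H_def)
  have n_pos: "n k > 0" for k using s(1) by (simp add: P_def n_def)
  have bad_small: "emeasure M (bad k (H k) (n k)) < ennreal ((1/2) ^ k)" for k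
    using s(1) by (simp add: P_def n_def H_def)
  have n_mono: "strict_mono n"
    using s(2) by (intro strict_mono_Suc_iff[THEN iffD2]) (simp add: Q_def n_def)
  have H_Suc: "H (Suc k) = H k \<union> (\<Union>j<n k. (T ^^ j) ` X k)" for k
    using s(2) by (simp add: Q_def n_def H_def)
  have H_mono: "H i \<subseteq> H j" if "i \<le> j" for i j
    using that by (rule lift_Suc_mono_le[rotated]) (simp add: H_Suc)

  \<comment> \<open>Stage \<open>k\<close> decides exactly the points of
    \<open>H (Suc k) - H k\<close>; those of the even stages are collected.\<close>
  define E where "E = (\<Union>k. H (Suc (2 * k)) - H (2 * k))"
  have E_sets [measurable]: "E \<in> sets M" unfolding E_def by measurable
  have orbit: "(T ^^ j) x \<in> H (Suc k)" if "x \<in> X k" "j < n k" for x j k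
    using that by (auto simp: H_Suc)
  have even: "y \<in> E \<or> y \<in> H (2 * k)" if "y \<in> H (Suc (2 * k))" for y k
    using that by (auto simp: E_def)
  have odd: "y \<in> H (Suc (2 * k))" if "y \<in> H (Suc (Suc (2 * k)))" "y \<in> E" for y k
  \<comment> \<open>A point of \<open>E\<close> is decided at an even stage \<open>2 * i\<close>.
    Being decided before stage \<open>2 * k + 2\<close>, it has \<open>i \<le> k\<close>, so it was
    decided at stage \<open>2 * k\<close> or earlier; stage \<open>2 * k + 1\<close> adds nothing to
    \<open>E\<close>.\<close>
  proof -
    obtain i where i: "y \<in> H (Suc (2 * i))" "y \<notin> H (2 * i)"
      using \<open>y \<in> E\<close> by (auto simp: E_def)
    have "i \<le> k"
      using i(2) that(1) H_mono[of "Suc (Suc (2 * k))" "2 * i"] by (force simp: not_le)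
    then show ?thesis using i(1) H_mono[of "Suc (2 * i)" "Suc (2 * k)"] by auto
  qed
  have even_av: "1 - 1 / Suc (2 * k) \<le> ?av (n (2 * k)) x E"
    if "x \<in> X (2 * k)" "x \<notin> bad (2 * k) (H (2 * k)) (n (2 * k))" for x k
  proof -
    let ?n = "n (2 * k)"
    \<comment> \<open>Every point of the orbit segment lies in \<open>E\<close> or was decided
      earlier, and for a point that is not bad the earlier decided ones take up a proportion below
      \<open>1 / Suc (2 * k)\<close>.\<close>
    have "(\<Sum>j<?n. 1) \<le> (\<Sum>j<?n. indicator E ((T ^^ j) x) + indicat_real (H (2 * k)) ((T ^^ j) x))"
    proof (rule sum_mono)
      fix j assume "j \<in> {..<?n}"
      then have "(T ^^ j) x \<in> E \<or> (T ^^ j) x \<in> H (2 * k)"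
        using even[OF orbit[OF that(1)]] by simp
      then show "1 \<le> indicator E ((T ^^ j) x) + indicat_real (H (2 * k)) ((T ^^ j) x)"
        by (auto simp: indicator_def)
    qed
    then have "1 \<le> ?av ?n x E + ?av ?n x (H (2 * k))"
      using n_pos[of "2 * k"]
      by (simp add: ergodic_average_def sum.distrib pos_le_divide_eq flip: add_divide_distrib)
    then show ?thesis using that by (simp add: bad_def)
  qed
  have odd_av: "?av (n (Suc (2 * k))) x E \<le> 1 / Suc (Suc (2 * k))"
    if "x \<in> X (Suc (2 * k))" "x \<notin> bad (Suc (2 * k)) (H (Suc (2 * k))) (n (Suc (2 * k)))" for x k
  proof -
    let ?n = "n (Suc (2 * k))"
    \<comment> \<open>Here the segment meets \<open>E\<close> only in points decided earlier, whose
      proportion is small.\<close>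
    have "(\<Sum>j<?n. indicator E ((T ^^ j) x)) \<le> (\<Sum>j<?n. indicat_real (H (Suc (2 * k))) ((T ^^ j) x))"
    proof (rule sum_mono)
      fix j assume "j \<in> {..<?n}"
      then have "(T ^^ j) x \<in> E \<longrightarrow> (T ^^ j) x \<in> H (Suc (2 * k))"
        using odd[OF orbit[OF that(1)]] by simp
      then show "indicator E ((T ^^ j) x) \<le> indicat_real (H (Suc (2 * k))) ((T ^^ j) x)"
        by (auto simp: indicator_def)
    qed
    then have "?av ?n x E \<le> ?av ?n x (H (Suc (2 * k)))"
      unfolding ergodic_average_def by (intro mult_left_mono) auto
    then show ?thesis using that by (simp add: bad_def)
  qed

  define p where "p k = n (2 * k)" for k
  define q where "q k = n (Suc (2 * k))" for k
  have p: "strict_mono p" and q: "strict_mono q"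
    using n_mono by (auto simp: p_def q_def strict_mono_def)
  have "AE x in M. \<forall>\<^sub>F k in sequentially. x \<in> space M - bad k (H k) (n k)"
  proof (rule borel_cantelli_AE1)
    fix k
    have "bad k (H k) (n k) = X k \<inter> {x\<in>space M. 1 / Suc k \<le> ?av (n k) x (H k)}"
      using sets.sets_into_space[OF X_sets] by (auto simp: bad_def)
    then show "bad k (H k) (n k) \<in> sets M" by simp
    show "emeasure M (bad k (H k) (n k)) < \<infinity>"
      using bad_small[of k] by (rule less_trans) simp
  next
    have "measure M (bad k (H k) (n k)) \<le> (1/2) ^ k" for k
      using bad_small[of k] unfolding measure_def by (intro enn2real_leI) auto
    then show "summable (\<lambda>k. measure M (bad k (H k) (n k)))"
      by (intro summable_comparison_test'[OF summable_geometric[of "1/2::real"]]) auto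
  qed
  then have lim: "AE x in M. (\<lambda>k. ?av (p k) x E) \<longlonglongrightarrow> 1 \<and> (\<lambda>k. ?av (q k) x E) \<longlonglongrightarrow> 0"
  proof (rule AE_mp, intro AE_I2 impI)
    fix x assume x: "x \<in> space M" and ev: "\<forall>\<^sub>F k in sequentially. x \<in> space M - bad k (H k) (n k)"
    obtain i where "x \<in> X i" using x X(2) by blast
    \<comment> \<open>Since the \<open>X k\<close> increase, a fixed point lies in all of them from
      some index on, so the estimates for points of \<open>X k\<close> eventually apply to
      it.\<close>
    then have Xk: "x \<in> X k" if "k \<ge> i" for k
      using that X(4) by (auto simp: incseq_def)
    have good: "\<forall>\<^sub>F k in sequentially. x \<in> X k \<and> x \<notin> bad k (H k) (n k)"
      using ev eventually_ge_at_top[of i] by eventually_elim (simp add: Xk)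
    have sub: "filterlim (\<lambda>k::nat. 2 * k) sequentially sequentially"
      "filterlim (\<lambda>k::nat. Suc (2 * k)) sequentially sequentially"
      by (auto intro!: filterlim_subseq simp: strict_mono_def)
    have inverse_lim: "(\<lambda>k. 1 / Suc k) \<longlonglongrightarrow> (0::real)"
      by (rule LIMSEQ_Suc[OF lim_1_over_n])
    show "(\<lambda>k. ?av (p k) x E) \<longlonglongrightarrow> 1 \<and> (\<lambda>k. ?av (q k) x E) \<longlonglongrightarrow> 0"
    proof
      show "(\<lambda>k. ?av (p k) x E) \<longlonglongrightarrow> 1"
      proof (rule tendsto_sandwich[where h = "\<lambda>_. 1"])
        show "\<forall>\<^sub>F k in sequentially. 1 - 1 / Suc (2 * k) \<le> ?av (p k) x E"
          using eventually_compose_filterlim[OF good sub(1)]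
          unfolding p_def by (rule eventually_mono) (rule even_av, blast+)
        show "(\<lambda>k. 1 - 1 / Suc (2 * k)) \<longlonglongrightarrow> (1::real)"
          using tendsto_diff[OF tendsto_const[of 1] filterlim_compose[OF inverse_lim sub(1)]] by simp
      qed (auto simp: ergodic_average_indicator_bounds)
      show "(\<lambda>k. ?av (q k) x E) \<longlonglongrightarrow> 0"
      proof (rule tendsto_sandwich[where f = "\<lambda>_. 0"])
        show "\<forall>\<^sub>F k in sequentially. ?av (q k) x E \<le> 1 / Suc (Suc (2 * k))"
          using eventually_compose_filterlim[OF good sub(2)]
          unfolding q_def by (rule eventually_mono) (rule odd_av, blast+)
        show "(\<lambda>k. 1 / Suc (Suc (2 * k))) \<longlonglongrightarrow> (0::real)"
          by (rule filterlim_compose[OF inverse_lim sub(2)])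
      qed (auto simp: ergodic_average_indicator_bounds)
    qed
  qed
  then have "AE x in M. limsup (\<lambda>n. ereal (?av n x E)) = 1 \<and> liminf (\<lambda>n. ereal (?av n x E)) = 0"
  proof (rule AE_mp, intro AE_I2 impI)
    fix x assume *: "(\<lambda>k. ?av (p k) x E) \<longlonglongrightarrow> 1 \<and> (\<lambda>k. ?av (q k) x E) \<longlonglongrightarrow> 0"
    let ?a = "\<lambda>n. ereal (?av n x E)"
    have "limsup (?a \<circ> p) = 1" "liminf (?a \<circ> q) = 0"
      using * by (auto simp: o_def one_ereal_def zero_ereal_def intro!: lim_imp_Limsup lim_imp_Liminf)
    \<comment> \<open>The subsequence limits give one half of each equality; the other half holds
      because all averages lie between 0 and 1.\<close>
    then have "1 \<le> limsup ?a" "liminf ?a \<le> 0"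
      using limsup_subseq_mono[OF p, of ?a] liminf_subseq_mono[OF q, of ?a] by simp_all
    moreover have "limsup ?a \<le> 1" "0 \<le> liminf ?a"
      by (auto intro!: Limsup_bounded Liminf_bounded simp: ergodic_average_indicator_bounds)
    ultimately show "limsup ?a = 1 \<and> liminf ?a = 0" by auto
  qed
  with lim show ?thesis
    using p q n_pos
    by (intro exI[of _ "indicator E"] exI[of _ p] exI[of _ q])
       (auto simp: p_def q_def indicator_def)
qed

end
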